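(* Let $\mathbf{k}=(k_1,\ldots,k_n)$ be a tuple of positive integers with weight $(a_1,\ldots,a_\ell;t_1,\ldots,t_\ell;a)$, and let $P_{\mathbf{k}}$ be the $\mathbf{k}$-Stirling poset. Then for every positive integer $m$, $B_{\mathbf{k}}(m)=\Omega(P_{\mathbf{k}},m)$ and $b_{\mathbf{k}}(m)=\overline{\Omega}(P_{\mathbf{k}},m)$.
   Context: For a tuple $\mathbf{k}=(k_1,\ldots,k_n)$ of positive integers, $K=k_1+\cdots+k_n$: a Stirling permutation of the multiset $\{1^{k_1},\ldots,n^{k_n}\}$ is a word $\sigma(1)\cdots\sigma(K)$ containing each $i$ exactly $k_i$ times such that $\sigma(i)=\sigma(j)$, $i<s<j$ imply $\sigma(s)\ge\sigma(i)$. An index $i\in\{1,\ldots,K\}$ is a descent if $i<K$ and $\sigma(i)>\sigma(i+1)$, or $i=K$. $A_{\mathbf{k},i}$ is the number of Stirling permutations with exactly $i$ descents, and $B_{\mathbf{k}}(m),b_{\mathbf{k}}(m)$ are defined by $\frac{\sum_{i=1}^{n}A_{\mathbf{k},i}x^i}{(1-x)^{K+1}}=\sum_{m\ge0}B_{\mathbf{k}}(m)x^m$ and $\frac{\sum_{i=K-n+1}^{K}A_{\mathbf{k},K+1-i}x^i}{(1-x)^{K+1}}=\sum_{m\ge0}b_{\mathbf{k}}(m)x^m$. Weight: $\mathbf{k}$ has length $\ell$ and weight $(a_1,\ldots,a_\ell;t_1,\ldots,t_\ell;a)$, with $a_i\ge1$, $t_i\ge2$, $a\ge0$, if $\mathbf{k}=(1^{a_1-1},t_1,1^{a_2-1},t_2,\ldots,1^{a_\ell-1},t_\ell,1^{a})$,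 where $1^r$ denotes $r$ consecutive entries equal to $1$. The $\mathbf{k}$-Stirling poset $P_{\mathbf{k}}$ has $K$ elements: for each $1\le i\le\ell$, elements $u_{i,1},\ldots,u_{i,a_i}$, $c_i$, $d_{i,1},\ldots,d_{i,t_i-2}$, plus $a$ further elements $e_1,\ldots,e_a$. Its order is generated by the relations $u_{i,j}<c_i$ ($1\le j\le a_i$), $c_i<d_{i,1}<\cdots<d_{i,t_i-2}$, and $d_{i,t_i-2}<c_{i+1}$ (or $c_i<c_{i+1}$ if $t_i=2$) for $i<\ell$; the $e_j$ are incomparable with all other elements. For a finite poset $P$, $\Omega(P,m)$ is the number of maps $f:P\to\{1,\ldots,m\}$ with $x<y\Rightarrow f(x)\le f(y)$, and $\overline{\Omega}(P,m)$ the number with $x<y\Rightarrow f(x)<f(y)$. *)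

theory Defs
  imports "HOL-Computational_Algebra.Formal_Power_Series" "HOL-Library.FuncSet"
begin

text \<open>
  The tuple \<open>(k_1, \<dots>, k_n)\<close> is the list \<open>k\<close> with \<open>n = length k\<close> and \<open>K = sum_list k\<close>.
  Lists are 0-based: the entry \<open>k_i\<close> is \<open>k ! (i - 1)\<close>, the letter \<open>\<sigma>(i)\<close> is \<open>\<sigma> ! (i - 1)\<close>.
\<close>

definition stirling_perms :: "nat list \<Rightarrow> nat list set" where
  "stirling_perms k =
     {\<sigma>. length \<sigma> = sum_list k \<and> set \<sigma> \<subseteq> {1..length k} \<and>
         (\<forall>i\<in>{1..length k}. count_list \<sigma> i = k ! (i - 1)) \<and>
         (\<forall>i s j. i < s \<and> s < j \<and> j < length \<sigma> \<and> \<sigma> ! i = \<sigma> ! j \<longrightarrow> \<sigma> ! s \<ge> \<sigma> ! i)}"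

definition descents :: "nat list \<Rightarrow> nat set" where
  "descents \<sigma> =
     {i \<in> {1..length \<sigma>}. (i < length \<sigma> \<and> \<sigma> ! (i - 1) > \<sigma> ! i) \<or> i = length \<sigma>}"

definition A_num :: "nat list \<Rightarrow> nat \<Rightarrow> nat" where
  "A_num k i = card {\<sigma> \<in> stirling_perms k. card (descents \<sigma>) = i}"

definition B_num :: "nat list \<Rightarrow> nat \<Rightarrow> rat" where
  "B_num k m =
     fps_nth ((\<Sum>i = 1..length k. of_nat (A_num k i) * fps_X ^ i)
              / (1 - fps_X) ^ (sum_list k + 1)) m"

definition b_num :: "nat list \<Rightarrow> nat \<Rightarrow> rat" where
  "b_num k m =
     fps_nth ((\<Sum>i = sum_list k - length k + 1..sum_list k.
                 of_nat (A_num k (sum_list k + 1 - i)) * fps_X ^ i)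
              / (1 - fps_X) ^ (sum_list k + 1)) m"

text \<open>
  The length \<open>\<ell>\<close> of the weight is \<open>length ts\<close>; it may be \<open>0\<close>, namely for \<open>k = (1, \<dots>, 1)\<close>.
\<close>

definition has_weight :: "nat list \<Rightarrow> nat list \<Rightarrow> nat list \<Rightarrow> nat \<Rightarrow> bool" where
  "has_weight k as ts a \<longleftrightarrow>
     length as = length ts \<and> (\<forall>x\<in>set as. x \<ge> 1) \<and> (\<forall>t\<in>set ts. t \<ge> 2) \<and>
     k = concat (map2 (\<lambda>x t. replicate (x - 1) 1 @ [t]) as ts) @ replicate a 1"

datatype stirling_elem = U nat nat | C nat | D nat nat | E nat

definition stirling_carrier :: "nat list \<Rightarrow> nat list \<Rightarrow> nat \<Rightarrow> stirling_elem set" where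
  "stirling_carrier as ts a =
     {U i j | i j. 1 \<le> i \<and> i \<le> length ts \<and> 1 \<le> j \<and> j \<le> as ! (i - 1)} \<union>
     {C i | i. 1 \<le> i \<and> i \<le> length ts} \<union>
     {D i j | i j. 1 \<le> i \<and> i \<le> length ts \<and> 1 \<le> j \<and> j \<le> ts ! (i - 1) - 2} \<union>
     {E j | j. 1 \<le> j \<and> j \<le> a}"

inductive_set stirling_gen :: "nat list \<Rightarrow> nat list \<Rightarrow> stirling_elem rel"
  for as ts :: "nat list" where
  UC: "\<lbrakk>1 \<le> i; i \<le> length ts; 1 \<le> j; j \<le> as ! (i - 1)\<rbrakk> \<Longrightarrow> (U i j, C i) \<in> stirling_gen as ts"
| CD: "\<lbrakk>1 \<le> i; i \<le> length ts; ts ! (i - 1) > 2\<rbrakk> \<Longrightarrow> (C i, D i 1) \<in> stirling_gen as ts"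
| DD: "\<lbrakk>1 \<le> i; i \<le> length ts; 1 \<le> j; j < ts ! (i - 1) - 2\<rbrakk>
         \<Longrightarrow> (D i j, D i (j + 1)) \<in> stirling_gen as ts"
| DC: "\<lbrakk>1 \<le> i; i < length ts; ts ! (i - 1) > 2\<rbrakk>
         \<Longrightarrow> (D i (ts ! (i - 1) - 2), C (i + 1)) \<in> stirling_gen as ts"
| CC: "\<lbrakk>1 \<le> i; i < length ts; ts ! (i - 1) = 2\<rbrakk> \<Longrightarrow> (C i, C (i + 1)) \<in> stirling_gen as ts"

definition stirling_order :: "nat list \<Rightarrow> nat list \<Rightarrow> nat \<Rightarrow> stirling_elem rel" where
  "stirling_order as ts a = Restr ((stirling_gen as ts)\<^sup>*) (stirling_carrier as ts a)"

text \<open>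
  A poset is given by its carrier \<open>P\<close> and its reflexive order relation \<open>r\<close>.  Maps out of \<open>P\<close>
  are extensional, so that each map on the carrier is counted once.
\<close>

definition Omega :: "'a set \<Rightarrow> 'a rel \<Rightarrow> nat \<Rightarrow> nat" where
  "Omega P r m =
     card {f \<in> P \<rightarrow>\<^sub>E {1..m}. \<forall>x\<in>P. \<forall>y\<in>P. (x, y) \<in> r \<and> x \<noteq> y \<longrightarrow> f x \<le> f y}"

definition Omega_strict :: "'a set \<Rightarrow> 'a rel \<Rightarrow> nat \<Rightarrow> nat" where
  "Omega_strict P r m =
     card {f \<in> P \<rightarrow>\<^sub>E {1..m}. \<forall>x\<in>P. \<forall>y\<in>P. (x, y) \<in> r \<and> x \<noteq> y \<longrightarrow> f x < f y}"

fun stirling_rank :: "stirling_elem \<Rightarrow> nat \<times> nat" where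
  "stirling_rank (U i j) = (i, 0)"
| "stirling_rank (C i) = (i, 1)"
| "stirling_rank (D i j) = (i, j + 1)"
| "stirling_rank (E j) = (0, 0)"

lemma stirling_gen_subset_carrier:
  "stirling_gen as ts \<subseteq> stirling_carrier as ts a \<times> stirling_carrier as ts a"
  by (auto simp: stirling_carrier_def elim!: stirling_gen.cases)

lemma partial_order_stirling_order:
  "partial_order_on (stirling_carrier as ts a) (stirling_order as ts a)"
proof -
  have "stirling_gen as ts \<subseteq> inv_image (less_than <*lex*> less_than) stirling_rank"
    by (auto elim!: stirling_gen.cases)
  then have "wf (stirling_gen as ts)"
    by (meson wf_subset wf_inv_image wf_lex_prod wf_less_than)
  then have "antisym ((stirling_gen as ts)\<^sup>*)"
    by (simp add: acyclic_impl_antisym_rtrancl wf_acyclic)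
  then show ?thesis
    unfolding partial_order_on_def preorder_on_def stirling_order_def
    by (auto simp: refl_on_def antisym_def intro!: transI dest: rtrancl_trans)
qed

end

theory Submission imports Defs begin

text \<open>
  Appending an entry \<open>t\<close> to \<open>k\<close> means inserting a block of \<open>t\<close> copies of a new largest letter into
  one of the \<open>K + 1\<close> gaps of a Stirling permutation; the number of descents is kept at a descent and
  grows by one elsewhere. For the generating functions \<open>F\<close> of \<open>B\<close> and \<open>b\<close> this reads
  \<open>F(k, t) = G^(t-1) x F(k)'\<close> with \<open>G = 1/(1-x)\<close> for \<open>B\<close> and \<open>G = x/(1-x)\<close> for \<open>b\<close>. On the poset side,
  the operator \<open>x d/dx\<close>, which multiplies the \<open>m\<close>-th coefficient by \<open>m\<close>, adds an isolated element, and
  multiplication by \<open>G\<close>, which takes partial sums, adds an element above all others. These are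
  exactly the steps that build the Stirling poset. Both cases are treated at once by a parameter
  \<open>s\<close>: \<open>s = 0\<close> for \<open>B\<close> and weak monotonicity, \<open>s = 1\<close> for \<open>b\<close> and strict monotonicity.
\<close>

section \<open>Inserting a block of the largest letter\<close>

definition insert_block :: "nat \<Rightarrow> nat \<Rightarrow> nat list \<Rightarrow> nat \<Rightarrow> nat list" where
  "insert_block N t \<sigma> p = take p \<sigma> @ replicate t N @ drop p \<sigma>"

lemma length_insert_block [simp]: "length (insert_block N t \<sigma> p) = length \<sigma> + t"
  by (simp add: insert_block_def)

lemma nth_insert_block:
  assumes "p \<le> length \<sigma>" "i < length \<sigma> + t"
  shows "insert_block N t \<sigma> p ! i = (if i < p then \<sigma> ! i else if i < p + t then N else \<sigma> ! (i - t))"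
  using assms by (auto simp: insert_block_def nth_append min_def)

lemma count_list_replicate: "count_list (replicate t x) y = (if x = y then t else 0)"
  by (induction t) auto

lemma count_list_insert_block:
  "count_list (insert_block N t \<sigma> p) i = count_list \<sigma> i + (if i = N then t else 0)"
proof -
  have "count_list \<sigma> i = count_list (take p \<sigma>) i + count_list (drop p \<sigma>) i"
    by (metis append_take_drop_id count_list_append)
  then show ?thesis by (simp add: insert_block_def count_list_replicate)
qed

lemma set_insert_block: "t \<ge> 1 \<Longrightarrow> set (insert_block N t \<sigma> p) = insert N (set \<sigma>)"
proof -
  assume "t \<ge> 1"
  moreover have "set \<sigma> = set (take p \<sigma>) \<union> set (drop p \<sigma>)"
    by (metis append_take_drop_id set_append)
  ultimately show ?thesis by (auto simp: insert_block_def)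
qed

definition nested :: "nat list \<Rightarrow> bool" where
  "nested \<sigma> \<longleftrightarrow> (\<forall>i s j. i < s \<and> s < j \<and> j < length \<sigma> \<and> \<sigma> ! i = \<sigma> ! j \<longrightarrow> \<sigma> ! i \<le> \<sigma> ! s)"

lemma nestedD: "nested \<sigma> \<Longrightarrow> i < s \<Longrightarrow> s < j \<Longrightarrow> j < length \<sigma> \<Longrightarrow> \<sigma> ! i = \<sigma> ! j \<Longrightarrow> \<sigma> ! i \<le> \<sigma> ! s"
  unfolding nested_def by blast

text \<open>Copies of \<open>N\<close> are adjacent, so only copies of \<open>N\<close> lie between
  two of them, and a copy of \<open>N\<close> between two older letters exceeds them. All other
  triples of positions are triples of \<open>\<sigma>\<close>, in the same order.\<close>

lemma nested_insert_block:
  assumes "\<forall>x\<in>set \<sigma>. x < N" "p \<le> length \<sigma>"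
  shows "nested (insert_block N t \<sigma> p) \<longleftrightarrow> nested \<sigma>"
proof
  assume n: "nested (insert_block N t \<sigma> p)"
  \<comment> \<open>\<open>h\<close> is the place of the letter \<open>\<sigma> ! i\<close> in the
    longer word; it is strictly increasing.\<close>
  define h where "h i = (if i < p then i else i + t)" for i
  have h: "insert_block N t \<sigma> p ! h i = \<sigma> ! i" if "i < length \<sigma>" for i
    using assms(2) that by (auto simp: nth_insert_block h_def)
  show "nested \<sigma>"
    unfolding nested_def
  proof (intro allI impI)
    fix i s j assume a: "i < s \<and> s < j \<and> j < length \<sigma> \<and> \<sigma> ! i = \<sigma> ! j"
    then have "h i < h s" "h s < h j" "h j < length (insert_block N t \<sigma> p)"
      by (auto simp: h_def)
    from nestedD[OF n this] a show "\<sigma> ! i \<le> \<sigma> ! s" by (simp add: h)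
  qed
next
  assume n: "nested \<sigma>"
  \<comment> \<open>Off the block, \<open>g\<close> undoes the shift of positions and is strictly
    increasing there.\<close>
  define g where "g i = (if i < p then i else i - t)" for i
  have N: "insert_block N t \<sigma> p ! i = N \<longleftrightarrow> p \<le> i \<and> i < p + t" if "i < length \<sigma> + t" for i
  proof -
    have "\<sigma> ! i \<noteq> N" if "i < length \<sigma>" for i using bspec[OF assms(1) nth_mem[OF that]] by simp
    then show ?thesis using that assms(2) by (auto simp: nth_insert_block)
  qed
  have g: "insert_block N t \<sigma> p ! i = \<sigma> ! g i" "g i < length \<sigma>"
    if "i < length \<sigma> + t" "\<not> (p \<le> i \<and> i < p + t)" for i
    using that assms(2) by (auto simp: nth_insert_block g_def)
  show "nested (insert_block N t \<sigma> p)"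
    unfolding nested_def
  proof (intro allI impI)
    fix i s j
    let ?w = "insert_block N t \<sigma> p"
    assume a: "i < s \<and> s < j \<and> j < length ?w \<and> ?w ! i = ?w ! j"
    then have l: "i < length \<sigma> + t" "s < length \<sigma> + t" "j < length \<sigma> + t" by auto
    show "?w ! i \<le> ?w ! s"
    proof (cases "?w ! i = N")
      case True
      then have "?w ! s = N" using a l N[of i] N[of j] N[of s] by auto
      with True show ?thesis by simp
    next
      case False
      then have i: "\<not> (p \<le> i \<and> i < p + t)" "\<not> (p \<le> j \<and> j < p + t)"
        using a l N[of i] N[of j] by auto
      show ?thesis
      proof (cases "?w ! s = N")
        case True
        then show ?thesis using g[OF l(1) i(1)] bspec[OF assms(1) nth_mem[of "g i" \<sigma>]] by simp
      next
        case False
        then have s: "\<not> (p \<le> s \<and> s < p + t)" using l N[of s] by auto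
        have "g i < g s" "g s < g j" using a i s by (auto simp: g_def)
        then show ?thesis
          using nestedD[OF n, of "g i" "g s" "g j"] g[OF l(1) i(1)] g[OF l(2) s] g[OF l(3) i(2)] a
          by simp
      qed
    qed
  qed
qed

lemma stirling_perms_nested:
  "stirling_perms k =
     {\<sigma>. length \<sigma> = sum_list k \<and> set \<sigma> \<subseteq> {1..length k} \<and>
         (\<forall>i\<in>{1..length k}. count_list \<sigma> i = k ! (i - 1)) \<and> nested \<sigma>}"
  by (simp add: stirling_perms_def nested_def)

lemma insert_block_in_stirling_perms_iff:
  assumes "t \<ge> 1" "p \<le> length \<sigma>" "set \<sigma> \<subseteq> {1..length k}"
  shows "insert_block (Suc (length k)) t \<sigma> p \<in> stirling_perms (k @ [t]) \<longleftrightarrow> \<sigma> \<in> stirling_perms k"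
proof -
  have "\<forall>x\<in>set \<sigma>. x < Suc (length k)" using assms(3) by auto
  note nest = nested_insert_block[OF this assms(2)]
  have "count_list \<sigma> (Suc (length k)) = 0"
    using assms(3) by (intro count_notin) auto
  moreover have "{1..Suc (length k)} = insert (Suc (length k)) {1..length k}" by auto
  ultimately have "(\<forall>i\<in>{1..length (k @ [t])}.
        count_list (insert_block (Suc (length k)) t \<sigma> p) i = (k @ [t]) ! (i - 1)) \<longleftrightarrow>
      (\<forall>i\<in>{1..length k}. count_list \<sigma> i = k ! (i - 1))"
    by (auto simp: count_list_insert_block nth_append)
  then show ?thesis
    using assms nest by (auto simp: stirling_perms_nested set_insert_block)
qed

text \<open>A smaller letter between two copies of the largest one would violate nesting, so the
  copies form a single run. Cutting out that run leaves \<open>\<sigma>\<close>, and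
  \<open>p\<close> is where it started.\<close>

lemma stirling_perms_snoc_obtain:
  assumes "w \<in> stirling_perms (k @ [t])" "t \<ge> 1"
  obtains \<sigma> p where "\<sigma> \<in> stirling_perms k" "p \<le> sum_list k"
    "w = insert_block (Suc (length k)) t \<sigma> p"
proof -
  let ?N = "Suc (length k)"
  have w: "set w \<subseteq> {1..?N}" "count_list w ?N = t" "nested w"
    using assms(1) by (auto simp: stirling_perms_nested nth_append)
  have "?N \<in> set w" using w(2) assms(2) by (metis count_notin not_one_le_zero)
  then obtain u v where uv: "w = u @ ?N # v" "?N \<notin> set u" by (auto dest: split_list_first)
  \<comment> \<open>\<open>r\<close> is the rest of the run that starts at the first
    \<open>?N\<close>; the remainder \<open>d\<close> turns out to contain no
    \<open>?N\<close>.\<close>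
  define r where "r = takeWhile (\<lambda>x. x = ?N) v"
  define d where "d = dropWhile (\<lambda>x. x = ?N) v"
  have v: "v = r @ d" by (simp add: r_def d_def)
  have r: "r = replicate (length r) ?N"
    unfolding r_def by (metis (mono_tags, lifting) replicate_eqI set_takeWhileD)
  have "?N \<notin> set d"
  proof
    assume N: "?N \<in> set d"
    \<comment> \<open>\<open>y\<close> is the letter that ends the run; a later \<open>?N\<close> in
      \<open>d\<close> would put \<open>y\<close> between two equal larger letters.\<close>
    then obtain y d' where d: "d = y # d'" by (cases d) auto
    have y: "y \<noteq> ?N" using d unfolding d_def by (simp add: dropWhile_eq_Cons_conv)
    with N d obtain q where q: "q < length d'" "d' ! q = ?N" by (auto simp: in_set_conv_nth)
    let ?s = "length u + Suc (length r)"
    have ws: "w = (u @ ?N # r) @ (y # d')" by (simp add: uv v d)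
    have "w ! length u = ?N" by (simp add: uv)
    moreover have "w ! ?s = y" unfolding ws by (simp add: nth_append)
    moreover have "w ! (?s + Suc q) = ?N" unfolding ws using q by (simp add: nth_append)
    moreover have "?s + Suc q < length w" unfolding ws using q by simp
    ultimately have "?N \<le> y" using nestedD[OF w(3), of "length u" ?s "?s + Suc q"] by simp
    moreover have "y \<in> set w" by (simp add: ws)
    ultimately show False using w(1) y by auto
  qed
  let ?\<sigma> = "u @ d"
  have wr: "w = u @ replicate (Suc (length r)) ?N @ d"
    using uv v r by simp
  have "count_list w ?N = Suc (length r)"
    unfolding wr using uv(2) \<open>?N \<notin> set d\<close> by (simp add: count_list_replicate)
  with w(2) have t: "Suc (length r) = t" by simp
  have ins: "w = insert_block ?N t ?\<sigma> (length u)"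
    by (simp add: insert_block_def wr t del: replicate.simps)
  have "set ?\<sigma> \<subseteq> {1..length k}"
  proof
    fix x assume "x \<in> set ?\<sigma>"
    moreover from this have "x \<noteq> ?N" using uv(2) \<open>?N \<notin> set d\<close> by auto
    moreover have "set ?\<sigma> \<subseteq> set w" by (auto simp: wr)
    ultimately show "x \<in> {1..length k}" using w(1) by force
  qed
  then have "?\<sigma> \<in> stirling_perms k"
    using insert_block_in_stirling_perms_iff[of t "length u" ?\<sigma> k] assms ins by simp
  moreover from this have "length u \<le> sum_list k" by (auto simp: stirling_perms_def)
  ultimately show ?thesis using ins that by blast
qed

text \<open>Deleting the largest letter recovers \<open>\<sigma>\<close>, and the length of the
  prefix before its first copy recovers \<open>p\<close>. That prefix stops at the block because
  \<open>t \<ge> 1\<close> makes the block nonempty.\<close>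

lemma bij_betw_insert_block:
  assumes "t \<ge> 1"
  shows "bij_betw (\<lambda>(\<sigma>, p). insert_block (Suc (length k)) t \<sigma> p)
    (stirling_perms k \<times> {..sum_list k}) (stirling_perms (k @ [t]))"
proof -
  let ?N = "Suc (length k)"
  have rec: "filter (\<lambda>x. x \<noteq> ?N) (insert_block ?N t \<sigma> p) = \<sigma> \<and>
      length (takeWhile (\<lambda>x. x \<noteq> ?N) (insert_block ?N t \<sigma> p)) = p"
    if "\<sigma> \<in> stirling_perms k" "p \<le> sum_list k" for \<sigma> p
  proof -
    have l: "length \<sigma> = sum_list k" and "set \<sigma> \<subseteq> {1..length k}"
      using that by (auto simp: stirling_perms_def)
    then have s: "\<forall>x\<in>set \<sigma>. x \<noteq> ?N" by auto
    then have "filter (\<lambda>x. x \<noteq> ?N) (take p \<sigma>) = take p \<sigma>"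
      "filter (\<lambda>x. x \<noteq> ?N) (drop p \<sigma>) = drop p \<sigma>"
      by (auto simp: filter_id_conv dest: in_set_takeD in_set_dropD)
    moreover have "takeWhile (\<lambda>x. x \<noteq> ?N) (take p \<sigma> @ replicate t ?N @ drop p \<sigma>) = take p \<sigma>"
    proof -
      obtain t' where "t = Suc t'" using assms by (cases t) auto
      then show ?thesis using s by (subst takeWhile_append2) (auto dest: in_set_takeD)
    qed
    ultimately show ?thesis using l that by (simp add: insert_block_def)
  qed
  have "inj_on (\<lambda>(\<sigma>, p). insert_block ?N t \<sigma> p) (stirling_perms k \<times> {..sum_list k})"
    by (rule inj_on_inverseI[where g = "\<lambda>w. (filter (\<lambda>x. x \<noteq> ?N) w, length (takeWhile (\<lambda>x. x \<noteq> ?N) w))"])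
      (use rec in auto)
  moreover have "(\<lambda>(\<sigma>, p). insert_block ?N t \<sigma> p) ` (stirling_perms k \<times> {..sum_list k})
      = stirling_perms (k @ [t])"
  proof (intro equalityI subsetI)
    fix w assume "w \<in> (\<lambda>(\<sigma>, p). insert_block ?N t \<sigma> p) ` (stirling_perms k \<times> {..sum_list k})"
    then obtain \<sigma> p where *: "\<sigma> \<in> stirling_perms k" "p \<le> sum_list k" "w = insert_block ?N t \<sigma> p"
      by auto
    moreover from *(1) have "length \<sigma> = sum_list k" "set \<sigma> \<subseteq> {1..length k}"
      by (auto simp: stirling_perms_def)
    ultimately show "w \<in> stirling_perms (k @ [t])"
      using insert_block_in_stirling_perms_iff[OF assms] by simp
  next
    fix w assume "w \<in> stirling_perms (k @ [t])"
    from stirling_perms_snoc_obtain[OF this assms]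
    show "w \<in> (\<lambda>(\<sigma>, p). insert_block ?N t \<sigma> p) ` (stirling_perms k \<times> {..sum_list k})"
      by (metis (no_types, lifting) SigmaI atMost_iff case_prod_conv image_eqI)
  qed
  ultimately show ?thesis by (simp add: bij_betw_def)
qed

lemma finite_stirling_perms: "finite (stirling_perms k)"
  by (rule finite_subset[OF _ finite_lists_length_eq[of "{1..length k}" "sum_list k"]])
    (auto simp: stirling_perms_def)

lemma sum_stirling_perms_snoc:
  assumes "t \<ge> 1"
  shows "(\<Sum>w\<in>stirling_perms (k @ [t]). F w) =
    (\<Sum>\<sigma>\<in>stirling_perms k. \<Sum>p\<le>sum_list k. F (insert_block (Suc (length k)) t \<sigma> p))"
  unfolding sum.reindex_bij_betw[OF bij_betw_insert_block[OF assms], symmetric]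
  by (simp add: sum.cartesian_product case_prod_unfold)

section \<open>Descents under block insertion\<close>

lemma finite_descents: "finite (descents \<sigma>)"
  by (simp add: descents_def)

text \<open>The end \<open>p + t\<close> of the block is always a descent, as \<open>N\<close> is
  followed by a smaller letter or ends the word. Index \<open>p\<close>, if positive, is an ascent
  into \<open>N\<close>, and inside the block neighbours agree. All other descents survive, shifted
  by \<open>t\<close> past the block.\<close>

lemma descents_insert_block:
  assumes "t \<ge> 1" "p \<le> length \<sigma>" "\<forall>x\<in>set \<sigma>. x < N"
  shows "descents (insert_block N t \<sigma> p) =
    insert (p + t) ((\<lambda>i. if i < p then i else i + t) ` (descents \<sigma> - {p}))" (is "?L = ?R")
proof -
  have lt: "\<sigma> ! i < N" if "i < length \<sigma>" for i using assms(3) that by simp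
  have nd: "\<not> N < \<sigma> ! i" if "i < length \<sigma>" for i using lt[OF that] by simp
  have "i \<in> ?L \<longleftrightarrow> i \<in> ?R" for i
  proof -
    \<comment> \<open>Index \<open>i\<close> compares the letters at 0-based positions
      \<open>i - 1\<close> and \<open>i\<close>, so \<open>i = p\<close> is the step into the block
      and \<open>i = p + t\<close> the step out of it.\<close>
    consider "i < p" | "i = p" | "p < i" "i < p + t" | "i = p + t" | "i > p + t" by linarith
    then show ?thesis
    proof cases
      case 1
      then have "i \<in> ?L \<longleftrightarrow> i \<in> descents \<sigma>"
        using assms(1,2) by (auto simp: descents_def nth_insert_block)
      moreover have "i \<in> ?R \<longleftrightarrow> i \<in> descents \<sigma>" using 1 by (auto simp: image_iff)
      ultimately show ?thesis by simp
    next
      case 2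
      then have "i \<notin> ?L"
        using assms(1,2) nd[of "p - 1"] by (auto simp: descents_def nth_insert_block)
      moreover have "i \<notin> ?R" using 2 assms(1) by auto
      ultimately show ?thesis by simp
    next
      case 3
      then have "i \<notin> ?L" using assms(1,2) by (auto simp: descents_def nth_insert_block)
      moreover have "i \<notin> ?R" using 3 assms(1) by auto
      ultimately show ?thesis by simp
    next
      case 4
      then have "i \<in> ?L" using assms(1,2) lt[of p]
        by (auto simp: descents_def nth_insert_block)
      then show ?thesis using 4 by simp
    next
      case 5
      \<comment> \<open>\<open>q\<close> is the index of \<open>\<sigma>\<close> that moves to
        \<open>i\<close>; the facts about it settle the truncated subtractions.\<close>
      define q where "q = i - t"
      have q: "i = q + t" "q > p" "\<not> i - 1 < p + t" "\<not> i - 1 < p" "i - 1 - t = q - 1"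
        using 5 by (auto simp: q_def)
      have "i \<in> ?L \<longleftrightarrow> q \<in> descents \<sigma>"
        using q(2-) assms(1,2) unfolding descents_def
        by (auto simp: nth_insert_block q(1) simp flip: One_nat_def)
      moreover have "i \<in> ?R \<longleftrightarrow> q \<in> descents \<sigma>" using q by (auto simp: image_iff)
      ultimately show ?thesis by simp
    qed
  qed
  then show ?thesis by blast
qed

text \<open>A descent at \<open>p\<close> is traded for the one at \<open>p + t\<close>; if
  \<open>p\<close> is no descent, the latter is an additional one.\<close>

lemma card_descents_insert_block:
  assumes "t \<ge> 1" "p \<le> length \<sigma>" "\<forall>x\<in>set \<sigma>. x < N"
  shows "card (descents (insert_block N t \<sigma> p)) =
    (if p \<in> descents \<sigma> then card (descents \<sigma>) else Suc (card (descents \<sigma>)))"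
proof -
  let ?h = "\<lambda>i. if i < p then i else i + t"
  have "inj_on ?h (descents \<sigma> - {p})" by (auto simp: inj_on_def split: if_splits)
  then have "card (?h ` (descents \<sigma> - {p})) = card (descents \<sigma> - {p})" by (rule card_image)
  moreover have "p + t \<notin> ?h ` (descents \<sigma> - {p})" by (auto split: if_splits)
  ultimately have "card (descents (insert_block N t \<sigma> p)) = Suc (card (descents \<sigma> - {p}))"
    unfolding descents_insert_block[OF assms]
    by (subst card_insert_disjoint) (auto simp: finite_descents)
  then show ?thesis
    using finite_descents[of \<sigma>]
    by (auto simp: card_Suc_Diff1 simp del: card_Diff_insert)
qed

lemma descents_subset: "descents \<sigma> \<subseteq> {1..length \<sigma>}"
  by (auto simp: descents_def)

lemma card_descents_le: "card (descents \<sigma>) \<le> length \<sigma>"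
  using card_mono[OF _ descents_subset] by fastforce

lemma card_descents_pos: "\<sigma> \<noteq> [] \<Longrightarrow> card (descents \<sigma>) \<ge> 1"
proof -
  assume "\<sigma> \<noteq> []"
  then have "length \<sigma> \<in> descents \<sigma>" by (cases \<sigma>) (auto simp: descents_def)
  then show ?thesis using finite_descents[of \<sigma>] by (simp add: Suc_le_eq card_gt_0_iff) blast
qed

text \<open>Each inserted block adds at most one descent, and there is one block per entry of
  \<open>k\<close>. This justifies the range \<open>1..length k\<close> of the sums over descent
  numbers.\<close>

lemma card_descents_stirling_le:
  assumes "\<sigma> \<in> stirling_perms k" "\<forall>x\<in>set k. x > 0"
  shows "card (descents \<sigma>) \<le> length k"
  using assms
proof (induction k arbitrary: \<sigma> rule: rev_induct)
  case Nil
  then show ?case using card_descents_le[of \<sigma>] by (auto simp: stirling_perms_def)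
next
  case (snoc t k)
  then have t: "t \<ge> 1" by auto
  from stirling_perms_snoc_obtain[OF snoc.prems(1) t] obtain \<tau> p where
    \<tau>: "\<tau> \<in> stirling_perms k" "p \<le> sum_list k" "\<sigma> = insert_block (Suc (length k)) t \<tau> p" .
  have "card (descents \<tau>) \<le> length k" using snoc \<tau> by auto
  moreover have "card (descents \<sigma>) \<le> Suc (card (descents \<tau>))"
    unfolding \<tau>(3) using \<tau>(1,2)
    by (subst card_descents_insert_block[OF t]) (auto simp: stirling_perms_def)
  ultimately show ?case by simp
qed

section \<open>The generating functions and their recursion\<close>

text \<open>
  The second branch is the exponent in the numerator of the generating function of \<open>b\<close>.
\<close>

definition descent_exponent :: "nat \<Rightarrow> nat list \<Rightarrow> nat" where
  "descent_exponent s \<sigma> =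
    (if s = 0 then card (descents \<sigma>) else length \<sigma> + 1 - card (descents \<sigma>))"

text \<open>Summed over permutations instead of descent numbers, so that insertion acts term by
  term. This also gives the recursion a start at \<open>k = []\<close>, where the sums in
  \<open>B_num\<close> and \<open>b_num\<close> are empty.\<close>

definition stirling_fps :: "nat \<Rightarrow> nat list \<Rightarrow> rat fps" where
  "stirling_fps s k = (\<Sum>\<sigma>\<in>stirling_perms k. fps_X ^ descent_exponent s \<sigma>)
    * inverse (1 - fps_X) ^ (sum_list k + 1)"

lemma descent_exponent_le: "descent_exponent s \<sigma> \<le> length \<sigma> + 1"
  using card_descents_le[of \<sigma>] by (simp add: descent_exponent_def)

text \<open>The gaps at the \<open>d\<close> descents keep the descent number, the others raise it
  by one. For \<open>s = 1\<close> the exponent is complementary, so the two kinds of gap swap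
  roles: the \<open>length \<sigma> + 1 - d\<close> gaps off the descents raise the exponent by
  \<open>t - 1\<close>, the \<open>d\<close> others by \<open>t\<close>. In terms of the exponent
  both cases read alike, up to the factor \<open>(fps_X ^ s) ^ (t - 1)\<close>.\<close>

lemma sum_descent_exponent_insert_block:
  assumes "t \<ge> 1" "s \<le> 1" "\<forall>x\<in>set \<sigma>. x < N"
  shows "(\<Sum>p\<le>length \<sigma>. fps_X ^ descent_exponent s (insert_block N t \<sigma> p)) =
    (fps_X ^ s) ^ (t - 1) *
    (of_nat (descent_exponent s \<sigma>) * fps_X ^ descent_exponent s \<sigma>
     + of_nat (length \<sigma> + 1 - descent_exponent s \<sigma>) * fps_X ^ (descent_exponent s \<sigma> + 1)
     :: rat fps)"
proof -
  let ?D = "descents \<sigma>"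
  define d where "d = card ?D"
  have d: "d \<le> length \<sigma>" using card_descents_le by (simp add: d_def)
  define e where "e b = (if s = 0 then (if b then d else Suc d)
      else length \<sigma> + t + 1 - (if b then d else Suc d))" for b
  have e: "descent_exponent s (insert_block N t \<sigma> p) = e (p \<in> ?D)" if "p \<le> length \<sigma>" for p
    by (simp add: descent_exponent_def e_def d_def
        card_descents_insert_block[OF assms(1) that assms(3)])
  have "(\<Sum>p\<le>length \<sigma>. fps_X ^ descent_exponent s (insert_block N t \<sigma> p)) =
      (\<Sum>p\<le>length \<sigma>. fps_X ^ e (p \<in> ?D) :: rat fps)"
    by (intro sum.cong) (auto simp: e)
  also have "\<dots> = (\<Sum>p\<in>?D. fps_X ^ e True) + (\<Sum>p\<in>{..length \<sigma>} - ?D. fps_X ^ e False)"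
  proof -
    have "?D \<subseteq> {..length \<sigma>}" using descents_subset[of \<sigma>] by auto
    from sum.subset_diff[OF this, of "\<lambda>p. fps_X ^ e (p \<in> ?D) :: rat fps"]
    show ?thesis by (simp add: add.commute)
  qed
  also have "\<dots> = of_nat d * fps_X ^ e True + of_nat (length \<sigma> + 1 - d) * fps_X ^ e False"
  proof -
    have "?D \<subseteq> {..length \<sigma>}" using descents_subset[of \<sigma>] by auto
    then have "card ({..length \<sigma>} - ?D) = length \<sigma> + 1 - d"
      by (subst card_Diff_subset) (auto simp: d_def finite_descents)
    then show ?thesis by (simp add: d_def)
  qed
  also have "\<dots> = (fps_X ^ s) ^ (t - 1) *
    (of_nat (descent_exponent s \<sigma>) * fps_X ^ descent_exponent s \<sigma>
     + of_nat (length \<sigma> + 1 - descent_exponent s \<sigma>) * fps_X ^ (descent_exponent s \<sigma> + 1))"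
  proof (cases "s = 0")
    case True
    then show ?thesis by (simp add: e_def descent_exponent_def d_def)
  next
    case False
    with assms(2) have s: "s = 1" by simp
    let ?c = "length \<sigma> + 1 - d"
    have "e True = t - 1 + (?c + 1)" "e False = t - 1 + ?c" "length \<sigma> + 1 - ?c = d"
      using d assms(1) s by (auto simp: e_def)
    moreover have "descent_exponent s \<sigma> = ?c" by (simp add: descent_exponent_def s d_def)
    ultimately show ?thesis by (simp only: s power_add power_one_right) (simp add: algebra_simps)
  qed
  finally show ?thesis .
qed

text \<open>For \<open>M = K + 1\<close> the numerator on the right is the bracket produced by
  inserting a block; this is how the derivative enters the recursion.\<close>

lemma fps_X_deriv_power_over:
  assumes "c \<le> M"
  shows "fps_X * fps_deriv (fps_X ^ c * inverse (1 - fps_X) ^ M) =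
    (of_nat c * fps_X ^ c + of_nat (M - c) * fps_X ^ (c + 1)) * inverse (1 - fps_X :: rat fps) ^ Suc M"
proof -
  let ?w = "inverse (1 - fps_X :: rat fps)"
  have inv: "?w * (1 - fps_X) = 1" by (rule inverse_mult_eq_1) simp
  have dw: "fps_deriv ?w = ?w ^ 2" by (subst fps_inverse_deriv) (simp_all add: power2_eq_square)
  have "fps_X * fps_deriv (fps_X ^ c * ?w ^ M) =
     of_nat c * (fps_X * fps_X ^ (c - 1)) * ?w ^ M + of_nat M * fps_X ^ (c + 1) * (?w ^ (M - 1) * ?w ^ 2)"
    by (simp add: fps_deriv_power dw fps_of_nat algebra_simps)
  \<comment> \<open>At \<open>c = 0\<close> the truncated \<open>c - 1\<close> is harmless because
    of the factor \<open>of_nat c\<close>.\<close>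
  also have "of_nat c * (fps_X * fps_X ^ (c - 1)) = of_nat c * (fps_X ^ c :: rat fps)"
    by (cases c) auto
  also have "of_nat M * fps_X ^ (c + 1) * (?w ^ (M - 1) * ?w ^ 2) = of_nat M * fps_X ^ (c + 1) * ?w ^ Suc M"
    by (cases M) (auto simp: power2_eq_square)
  \<comment> \<open>The factor \<open>?w * (1 - fps_X) = 1\<close> brings the first term over the
    common denominator.\<close>
  also have "of_nat c * fps_X ^ c * ?w ^ M = of_nat c * fps_X ^ c * (?w * (1 - fps_X)) * ?w ^ M"
    unfolding inv by simp
  also have "\<dots> + of_nat M * fps_X ^ (c + 1) * ?w ^ Suc M =
     (of_nat c * fps_X ^ c + (of_nat M - of_nat c) * fps_X ^ (c + 1)) * ?w ^ Suc M"
    by (simp add: algebra_simps)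
  finally show ?thesis using assms by (simp only: of_nat_diff)
qed

lemma stirling_fps_snoc:
  assumes "t \<ge> 1" "s \<le> 1"
  shows "stirling_fps s (k @ [t]) =
    (fps_X ^ s * inverse (1 - fps_X)) ^ (t - 1) * (fps_X * fps_deriv (stirling_fps s k))"
proof -
  let ?w = "inverse (1 - fps_X :: rat fps)" and ?K = "sum_list k"
  let ?T = "\<lambda>\<sigma>. (of_nat (descent_exponent s \<sigma>) * fps_X ^ descent_exponent s \<sigma>
     + of_nat (?K + 1 - descent_exponent s \<sigma>) * fps_X ^ (descent_exponent s \<sigma> + 1) :: rat fps)"
  have "(\<Sum>w\<in>stirling_perms (k @ [t]). fps_X ^ descent_exponent s w) =
      (\<Sum>\<sigma>\<in>stirling_perms k. (fps_X ^ s) ^ (t - 1) * ?T \<sigma>)"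
    unfolding sum_stirling_perms_snoc[OF assms(1)]
  proof (intro sum.cong refl)
    fix \<sigma> assume "\<sigma> \<in> stirling_perms k"
    then have l: "length \<sigma> = ?K" "set \<sigma> \<subseteq> {1..length k}" by (auto simp: stirling_perms_def)
    then have "\<forall>x\<in>set \<sigma>. x < Suc (length k)" by auto
    from sum_descent_exponent_insert_block[of t s \<sigma>, OF assms this] l(1)
    show "(\<Sum>p\<le>?K. fps_X ^ descent_exponent s (insert_block (Suc (length k)) t \<sigma> p)) =
        (fps_X ^ s) ^ (t - 1) * ?T \<sigma>" by simp
  qed
  \<comment> \<open>The exponent of \<open>?w\<close> grows by \<open>t\<close>: one factor belongs
    to the derivative, the other \<open>t - 1\<close> pair with the powers of
    \<open>fps_X ^ s\<close>.\<close>
  moreover have "sum_list (k @ [t]) + 1 = (t - 1) + Suc (?K + 1)" using assms by simp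
  ultimately have "stirling_fps s (k @ [t]) =
      (\<Sum>\<sigma>\<in>stirling_perms k. (fps_X ^ s) ^ (t - 1) * ?T \<sigma>) * (?w ^ (t - 1) * ?w ^ Suc (?K + 1))"
    unfolding stirling_fps_def by (simp only: power_add)
  also have "\<dots> = (fps_X ^ s * ?w) ^ (t - 1) * (\<Sum>\<sigma>\<in>stirling_perms k. ?T \<sigma> * ?w ^ Suc (?K + 1))"
    by (simp only: power_mult_distrib sum_distrib_left sum_distrib_right mult_ac)
  also have "(\<Sum>\<sigma>\<in>stirling_perms k. ?T \<sigma> * ?w ^ Suc (?K + 1)) =
      (\<Sum>\<sigma>\<in>stirling_perms k. fps_X * fps_deriv (fps_X ^ descent_exponent s \<sigma> * ?w ^ (?K + 1)))"
  proof (intro sum.cong refl)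
    fix \<sigma> assume "\<sigma> \<in> stirling_perms k"
    then have "descent_exponent s \<sigma> \<le> ?K + 1"
      using descent_exponent_le[of s \<sigma>] by (auto simp: stirling_perms_def)
    from fps_X_deriv_power_over[OF this]
    show "?T \<sigma> * ?w ^ Suc (?K + 1) =
        fps_X * fps_deriv (fps_X ^ descent_exponent s \<sigma> * ?w ^ (?K + 1))" by (rule sym)
  qed
  also have "\<dots> = fps_X * fps_deriv (stirling_fps s k)"
    by (simp only: stirling_fps_def sum_distrib_left sum_distrib_right fps_deriv_sum)
  finally show ?thesis .
qed

text \<open>Grouping by descent number misses no permutation: the last index of a nonempty word is a
  descent, and there are at most \<open>length k\<close> descents. \<open>F\<close> is arbitrary
  because the two numerators use different powers.\<close>

lemma sum_by_descents:
  assumes "k \<noteq> []" "\<forall>x\<in>set k. x > 0"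
  shows "(\<Sum>i=1..length k. of_nat (A_num k i) * F i) = (\<Sum>\<sigma>\<in>stirling_perms k. F (card (descents \<sigma>)) :: rat fps)"
proof -
  have "sum_list k > 0" using assms by (cases k) auto
  then have "\<sigma> \<noteq> []" if "\<sigma> \<in> stirling_perms k" for \<sigma>
    using that by (auto simp: stirling_perms_def simp del: sum_list_eq_0_iff)
  then have "card (descents \<sigma>) \<in> {1..length k}" if "\<sigma> \<in> stirling_perms k" for \<sigma>
    using card_descents_stirling_le[OF that assms(2)] card_descents_pos[of \<sigma>] that by simp
  then have "(\<Sum>\<sigma>\<in>stirling_perms k. F (card (descents \<sigma>))) =
      (\<Sum>i=1..length k. \<Sum>\<sigma>\<in>{\<sigma>\<in>stirling_perms k. card (descents \<sigma>) = i}. F (card (descents \<sigma>)))"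
    by (intro sum.group[symmetric] finite_stirling_perms) auto
  also have "\<dots> = (\<Sum>i=1..length k. of_nat (A_num k i) * F i)"
    by (intro sum.cong) (auto simp: A_num_def)
  finally show ?thesis by simp
qed

lemma fps_divide_power_one_minus_X: "f / (1 - fps_X) ^ n = f * inverse (1 - fps_X :: rat fps) ^ n"
  by (subst fps_divide_unit) (auto simp: fps_inverse_power)

lemma B_num_eq_stirling_fps:
  assumes "k \<noteq> []" "\<forall>x\<in>set k. x > 0"
  shows "B_num k m = fps_nth (stirling_fps 0 k) m"
  unfolding B_num_def stirling_fps_def sum_by_descents[OF assms] fps_divide_power_one_minus_X
  by (simp add: descent_exponent_def)

lemma b_num_eq_stirling_fps:
  assumes "k \<noteq> []" "\<forall>x\<in>set k. x > 0"
  shows "b_num k m = fps_nth (stirling_fps 1 k) m"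
proof -
  let ?K = "sum_list k" and ?n = "length k"
  have n: "?n \<le> ?K" using assms(2) by (induction k) auto
  \<comment> \<open>The reflection of \<open>i\<close> to \<open>?K + 1 - i\<close> exchanges the
    two ranges; \<open>?n \<le> ?K\<close> keeps the subtractions exact.\<close>
  have "(\<Sum>i = ?K - ?n + 1..?K. of_nat (A_num k (?K + 1 - i)) * fps_X ^ i) =
      (\<Sum>i=1..?n. of_nat (A_num k i) * fps_X ^ (?K + 1 - i) :: rat fps)"
    by (rule sum.reindex_bij_witness[where i = "\<lambda>i. ?K + 1 - i" and j = "\<lambda>i. ?K + 1 - i"])
      (use n in auto)
  also have "\<dots> = (\<Sum>\<sigma>\<in>stirling_perms k. fps_X ^ (?K + 1 - card (descents \<sigma>)))"
    by (rule sum_by_descents[OF assms])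
  also have "\<dots> = (\<Sum>\<sigma>\<in>stirling_perms k. fps_X ^ descent_exponent 1 \<sigma>)"
    by (intro sum.cong) (auto simp: descent_exponent_def stirling_perms_def)
  finally show ?thesis
    unfolding b_num_def stirling_fps_def fps_divide_power_one_minus_X by simp
qed

section \<open>Counting order-preserving maps\<close>

text \<open>\<open>lt\<close> is meant as a strict order; the gap \<open>s\<close> makes the maps
  weakly increasing for \<open>s = 0\<close> and strictly increasing for
  \<open>s = 1\<close>.\<close>

definition gap_maps :: "nat \<Rightarrow> ('a \<Rightarrow> 'a \<Rightarrow> bool) \<Rightarrow> 'a set \<Rightarrow> nat \<Rightarrow> ('a \<Rightarrow> nat) set" where
  "gap_maps s lt P m = {f \<in> P \<rightarrow>\<^sub>E {1..m}. \<forall>x\<in>P. \<forall>y\<in>P. lt x y \<longrightarrow> f x + s \<le> f y}"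

lemma finite_gap_maps: "finite P \<Longrightarrow> finite (gap_maps s lt P m)"
  unfolding gap_maps_def by (rule finite_subset[of _ "P \<rightarrow>\<^sub>E {1..m}"]) (auto intro: finite_PiE)

text \<open>The maps are fibred over their value \<open>v\<close> at \<open>z\<close>;
  \<open>g v\<close> is the upper bound that this choice leaves for the values on
  \<open>P\<close>.\<close>

lemma card_gap_maps_insert:
  assumes "finite P" "z \<notin> P"
    and step: "\<And>f v. f \<in> extensional P \<Longrightarrow> v \<in> {1..m} \<Longrightarrow>
      f(z := v) \<in> gap_maps s lt (insert z P) m \<longleftrightarrow> f \<in> gap_maps s lt P (g v)"
  shows "card (gap_maps s lt (insert z P) m) = (\<Sum>v=1..m. card (gap_maps s lt P (g v)))"
proof -
  have ext: "gap_maps s lt Q n \<subseteq> extensional Q" for Q n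
    by (auto simp: gap_maps_def PiE_def)
  have "bij_betw (\<lambda>(v, f). f(z := v)) (SIGMA v:{1..m}. gap_maps s lt P (g v))
          (gap_maps s lt (insert z P) m)"
  \<comment> \<open>\<open>undefined\<close> is what an extensional map on \<open>P\<close> takes at
    \<open>z\<close>, so resetting \<open>z\<close> restricts the map to \<open>P\<close>.\<close>
  proof (rule bij_betw_byWitness[where f' = "\<lambda>f. (f z, f(z := undefined))"], goal_cases)
    case 1
    show ?case
      using assms(2) ext by (force simp: extensional_def)
  next
    case 2
    show ?case by auto
  next
    case 3
    show ?case using step subsetD[OF ext] by (auto simp del: atLeastAtMost_iff)
  next
    case 4
    show ?case
    proof
      fix h assume "h \<in> (\<lambda>f. (f z, f(z := undefined))) ` gap_maps s lt (insert z P) m"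
      then obtain f where f: "f \<in> gap_maps s lt (insert z P) m" "h = (f z, f(z := undefined))"
        by auto
      have "f z \<in> {1..m}" using f(1) by (auto simp: gap_maps_def)
      moreover have "f(z := undefined) \<in> extensional P"
        using f(1) ext assms(2) by (force simp: extensional_def)
      ultimately have "f(z := undefined) \<in> gap_maps s lt P (g (f z))"
        using step[of "f(z := undefined)" "f z"] f(1) by simp
      with \<open>f z \<in> {1..m}\<close> f(2) show "h \<in> (SIGMA v:{1..m}. gap_maps s lt P (g v))" by simp
    qed
  qed
  then have "card (gap_maps s lt (insert z P) m) = card (SIGMA v:{1..m}. gap_maps s lt P (g v))"
    by (simp add: bij_betw_same_card)
  also have "\<dots> = (\<Sum>v=1..m. card (gap_maps s lt P (g v)))"
    using assms(1) by (subst card_SigmaI) (auto intro: finite_gap_maps)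
  finally show ?thesis .
qed

lemma card_gap_maps_isolated:
  assumes "finite P" "z \<notin> P" "\<And>x. x \<in> insert z P \<Longrightarrow> \<not> lt x z \<and> \<not> lt z x"
  shows "card (gap_maps s lt (insert z P) m) = m * card (gap_maps s lt P m)"
proof -
  have "card (gap_maps s lt (insert z P) m) = (\<Sum>v=1..m. card (gap_maps s lt P m))"
  proof (rule card_gap_maps_insert)
    fix f :: "'a \<Rightarrow> nat" and v :: nat
    assume f: "f \<in> extensional P" and v: "v \<in> {1..m}"
    have "f(z := v) \<in> extensional (insert z P)" using f by (auto simp: extensional_def)
    moreover have "x \<noteq> z" if "x \<in> P" for x using that assms(2) by auto
    ultimately show "f(z := v) \<in> gap_maps s lt (insert z P) m \<longleftrightarrow> f \<in> gap_maps s lt P m"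
      using f v assms(3) by (auto simp: gap_maps_def PiE_def Pi_def)
  qed (use assms in auto)
  then show ?thesis by simp
qed

text \<open>Once \<open>z\<close> has the value \<open>v\<close>, all other values must stay within
  \<open>v - s\<close>, which implies the bound \<open>m\<close>. The outcome is a partial sum of
  the counts, shifted by one for \<open>s = 1\<close>.\<close>

lemma card_gap_maps_top:
  assumes "finite P" "z \<notin> P" "\<not> lt z z" "\<And>x. x \<in> P \<Longrightarrow> lt x z \<and> \<not> lt z x"
  shows "card (gap_maps s lt (insert z P) m) = (\<Sum>v=1..m. card (gap_maps s lt P (v - s)))"
proof (rule card_gap_maps_insert)
  fix f :: "'a \<Rightarrow> nat" and v :: nat
  assume f: "f \<in> extensional P" and v: "v \<in> {1..m}"
  have e: "f(z := v) \<in> extensional (insert z P)" using f by (auto simp: extensional_def)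
  have z: "x \<noteq> z" if "x \<in> P" for x using that assms(2) by auto
  have "f(z := v) \<in> gap_maps s lt (insert z P) m \<longleftrightarrow>
      (\<forall>x\<in>P. f x \<in> {1..m} \<and> f x + s \<le> v) \<and> (\<forall>x\<in>P. \<forall>y\<in>P. lt x y \<longrightarrow> f x + s \<le> f y)"
    using e f v z assms(3,4) by (auto simp: gap_maps_def PiE_def Pi_def)
  \<comment> \<open>When \<open>v \<le> s\<close>, the interval \<open>{1..v - s}\<close> is empty,
    and \<open>f x + s \<le> v\<close> fails as well since \<open>f x \<ge> 1\<close>.\<close>
  also have "(\<forall>x\<in>P. f x \<in> {1..m} \<and> f x + s \<le> v) \<longleftrightarrow> (\<forall>x\<in>P. f x \<in> {1..v - s})"
    using v by force
  also have "\<dots> \<and> (\<forall>x\<in>P. \<forall>y\<in>P. lt x y \<longrightarrow> f x + s \<le> f y) \<longleftrightarrow> f \<in> gap_maps s lt P (v - s)"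
    using f by (simp add: gap_maps_def PiE_def Pi_def Ball_def)
  finally show "f(z := v) \<in> gap_maps s lt (insert z P) m \<longleftrightarrow> f \<in> gap_maps s lt P (v - s)" .
qed (use assms in auto)

section \<open>The Stirling order in closed form\<close>

text \<open>On the carrier this is the strict Stirling order: lexicographic comparison of ranks,
  except that nothing lies below a \<open>U\<close> and an \<open>E\<close> is comparable to
  nothing. As \<open>as\<close> and \<open>ts\<close> do not occur, enlarging the carrier leaves the
  relation unchanged.\<close>

fun stirling_less :: "stirling_elem \<Rightarrow> stirling_elem \<Rightarrow> bool" where
  "stirling_less (E j) y = False"
| "stirling_less x (U i j) = False"
| "stirling_less x (E j) = False"
| "stirling_less x y =
    ((stirling_rank x, stirling_rank y) \<in> less_than <*lex*> less_than)"

lemma stirling_less_trans: "stirling_less x y \<Longrightarrow> stirling_less y z \<Longrightarrow> stirling_less x z"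
  by (cases x; cases y; cases z) auto

lemma stirling_less_irrefl: "\<not> stirling_less x x"
  by (cases x) auto

lemma stirling_gen_rtrancl_CD:
  assumes "1 \<le> i" "i \<le> length ts" "1 \<le> j" "j \<le> ts ! (i - 1) - 2"
  shows "(C i, D i j) \<in> (stirling_gen as ts)\<^sup>*"
  using assms(3,4)
proof (induction j rule: dec_induct)
  case base
  with assms show ?case by (intro r_into_rtrancl stirling_gen.CD) auto
next
  case (step j)
  with assms have "(D i j, D i (j + 1)) \<in> stirling_gen as ts"
    by (intro stirling_gen.DD) auto
  with step show ?case by (auto intro: rtrancl_into_rtrancl)
qed

lemma stirling_gen_rtrancl_DD:
  assumes "1 \<le> i" "i \<le> length ts" "1 \<le> j" "j \<le> j'" "j' \<le> ts ! (i - 1) - 2"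
  shows "(D i j, D i j') \<in> (stirling_gen as ts)\<^sup>*"
  using assms(4,5)
proof (induction j' rule: dec_induct)
  case (step j')
  with assms have "(D i j', D i (j' + 1)) \<in> stirling_gen as ts"
    by (intro stirling_gen.DD) auto
  with step show ?case by (auto intro: rtrancl_into_rtrancl)
qed auto

lemma stirling_gen_rtrancl_DC:
  assumes "1 \<le> i" "i < length ts" "1 \<le> j" "j \<le> ts ! (i - 1) - 2"
  shows "(D i j, C (i + 1)) \<in> (stirling_gen as ts)\<^sup>*"
proof -
  have "(D i j, D i (ts ! (i - 1) - 2)) \<in> (stirling_gen as ts)\<^sup>*"
    using assms by (intro stirling_gen_rtrancl_DD) auto
  moreover have "(D i (ts ! (i - 1) - 2), C (i + 1)) \<in> stirling_gen as ts"
    using assms by (intro stirling_gen.DC) auto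
  ultimately show ?thesis by (rule rtrancl_into_rtrancl)
qed

lemma stirling_gen_rtrancl_CC:
  assumes "\<forall>t\<in>set ts. t \<ge> 2" "1 \<le> i" "i \<le> i'" "i' \<le> length ts"
  shows "(C i, C i') \<in> (stirling_gen as ts)\<^sup>*"
  using assms(3,4)
proof (induction i' rule: dec_induct)
  case (step i')
  have "(C i', C (i' + 1)) \<in> (stirling_gen as ts)\<^sup>*"
  \<comment> \<open>An entry 2 links the two \<open>C\<close> directly; otherwise the path runs
    through the \<open>D\<close> chain between them.\<close>
  proof (cases "ts ! (i' - 1) = 2")
    case True
    with step assms show ?thesis by (intro r_into_rtrancl stirling_gen.CC) auto
  next
    case False
    have "i' - 1 < length ts" using step assms by linarith
    then have "ts ! (i' - 1) \<ge> 2" using assms(1) by simp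
    with False have t: "ts ! (i' - 1) > 2" by simp
    have "(C i', D i' 1) \<in> (stirling_gen as ts)\<^sup>*"
      using step assms t by (intro stirling_gen_rtrancl_CD) auto
    moreover have "(D i' 1, C (i' + 1)) \<in> (stirling_gen as ts)\<^sup>*"
      using step assms t by (intro stirling_gen_rtrancl_DC) auto
    ultimately show ?thesis by (rule rtrancl_trans)
  qed
  with step show ?case by (auto intro: rtrancl_trans)
qed auto

text \<open>Every generator is an instance of the transitive \<open>stirling_less\<close>.
  Conversely, a path climbs to some \<open>C\<close>, follows the chain of the \<open>C i\<close>
  and may end in a \<open>D\<close> chain, or it stays within one \<open>D\<close> chain.\<close>

lemma stirling_order_iff:
  assumes "\<forall>t\<in>set ts. t \<ge> 2" "x \<in> stirling_carrier as ts a" "y \<in> stirling_carrier as ts a"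
  shows "(x, y) \<in> stirling_order as ts a \<and> x \<noteq> y \<longleftrightarrow> stirling_less x y"
proof
  assume "(x, y) \<in> stirling_order as ts a \<and> x \<noteq> y"
  then have "(x, y) \<in> (stirling_gen as ts)\<^sup>+"
    by (auto simp: stirling_order_def rtrancl_eq_or_trancl)
  then show "stirling_less x y"
  proof (induction rule: trancl_induct)
    case (base y)
    then show ?case by cases auto
  next
    case (step y z)
    from step(2) have "stirling_less y z" by cases auto
    with step show ?case by (blast intro: stirling_less_trans)
  qed
next
  let ?R = "(stirling_gen as ts)\<^sup>*"
  assume less: "stirling_less x y"
  have up: "(C i, y) \<in> ?R"
    if "1 \<le> i" "y = C i' \<or> y = D i' j'" "i \<le> i'" for i i' j'
  proof -
    from assms(3) that have i': "i' \<le> length ts" by (auto simp: stirling_carrier_def)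
    have *: "(C i, C i') \<in> ?R" using assms(1) that i' by (intro stirling_gen_rtrancl_CC) auto
    show ?thesis
    proof (cases "y = C i'")
      case False
      then have "(C i', y) \<in> ?R"
        using that assms(3) by (auto simp: stirling_carrier_def intro!: stirling_gen_rtrancl_CD)
      with * show ?thesis by (rule rtrancl_trans)
    qed (use * in simp)
  qed
  obtain i' j' where y: "y = C i' \<or> y = D i' j'"
    using less by (cases x; cases y) auto
  from assms(3) y have i': "i' \<le> length ts" by (auto simp: stirling_carrier_def)
  have "(x, y) \<in> ?R"
  proof (cases x)
    case (U i j)
    then have "(x, C i) \<in> ?R" using assms(2)
      by (auto simp: stirling_carrier_def intro!: stirling_gen.UC)
    moreover have "(C i, y) \<in> ?R"
      using assms(2) U less y by (intro up[OF _ y]) (auto simp: stirling_carrier_def)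
    ultimately show ?thesis by (rule rtrancl_trans)
  next
    case (C i)
    then show ?thesis
      unfolding C using assms(2) less y C by (intro up[OF _ y]) (auto simp: stirling_carrier_def)
  next
    case (D i j)
    show ?thesis
    proof (cases "i < i'")
      case True
      then have "(x, C (i + 1)) \<in> ?R"
        unfolding D using assms(2) D i' by (intro stirling_gen_rtrancl_DC) (auto simp: stirling_carrier_def)
      moreover have "(C (i + 1), y) \<in> ?R" using True by (intro up[OF _ y]) auto
      ultimately show ?thesis by (rule rtrancl_trans)
    next
      case False
      \<comment> \<open>\<open>C i'\<close> with \<open>i' \<le> i\<close> is not above
        \<open>D i j\<close>, so \<open>y\<close> is a later element of the same \<open>D\<close>
        chain.\<close>
      with less D y have "y = D i j'" "j < j'" by auto
      with D assms(2,3) show ?thesis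
        by (auto simp: stirling_carrier_def intro!: stirling_gen_rtrancl_DD)
    qed
  qed (use less in simp)
  with assms less show "(x, y) \<in> stirling_order as ts a \<and> x \<noteq> y"
    by (auto simp: stirling_order_def stirling_less_irrefl)
qed

lemma Omega_eq_gap_maps:
  assumes "\<forall>t\<in>set ts. t \<ge> 2"
  shows "Omega (stirling_carrier as ts a) (stirling_order as ts a) m =
      card (gap_maps 0 stirling_less (stirling_carrier as ts a) m)"
  unfolding Omega_def gap_maps_def using stirling_order_iff[OF assms]
  by (intro arg_cong[where f = card] Collect_cong conj_cong ball_cong refl) auto

lemma Omega_strict_eq_gap_maps:
  assumes "\<forall>t\<in>set ts. t \<ge> 2"
  shows "Omega_strict (stirling_carrier as ts a) (stirling_order as ts a) m =
      card (gap_maps 1 stirling_less (stirling_carrier as ts a) m)"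
  unfolding Omega_strict_def gap_maps_def using stirling_order_iff[OF assms]
  by (intro arg_cong[where f = card] Collect_cong conj_cong ball_cong refl) auto

section \<open>Building up the carrier\<close>

lemma finite_stirling_carrier: "finite (stirling_carrier as ts a)"
proof -
  have "stirling_carrier as ts a \<subseteq>
      (\<lambda>(i, j). U i j) ` (SIGMA i:{1..length ts}. {1..as ! (i - 1)}) \<union> C ` {1..length ts} \<union>
      (\<lambda>(i, j). D i j) ` (SIGMA i:{1..length ts}. {1..ts ! (i - 1) - 2}) \<union> E ` {1..a}"
    by (auto simp: stirling_carrier_def)
  then show ?thesis by (rule finite_subset) auto
qed

lemma stirling_carrier_Nil: "stirling_carrier [] [] 0 = {}"
  by (auto simp: stirling_carrier_def)

lemma stirling_carrier_Suc:
  "stirling_carrier as ts (Suc a) = insert (E (Suc a)) (stirling_carrier as ts a)"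
  by (auto simp: stirling_carrier_def)

text \<open>Written in the order of adjunction: the \<open>U\<close> while still isolated, then
  \<open>C\<close> above everything, then the \<open>D\<close> one by one, each on top. An
  \<open>E\<close> would lie below none of these, so the \<open>E\<close> are added last and the
  parameter here is \<open>0\<close>.\<close>

lemma stirling_carrier_snoc:
  assumes "length as = length ts"
  shows "stirling_carrier (as @ [x]) (ts @ [t]) 0 =
    D (Suc (length ts)) ` {1..t - 2} \<union>
    insert (C (Suc (length ts))) (U (Suc (length ts)) ` {1..x} \<union> stirling_carrier as ts 0)"
proof (rule set_eqI)
  show "e \<in> stirling_carrier (as @ [x]) (ts @ [t]) 0 \<longleftrightarrow> e \<in> D (Suc (length ts)) ` {1..t - 2} \<union>
    insert (C (Suc (length ts))) (U (Suc (length ts)) ` {1..x} \<union> stirling_carrier as ts 0)" for e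
    using assms by (cases e) (auto simp: stirling_carrier_def nth_append le_Suc_eq image_iff)
qed

section \<open>Matching the two recursions\<close>

lemma fps_nth_X_deriv: "fps_nth (fps_X * fps_deriv f) m = of_nat m * fps_nth f m"
  for f :: "rat fps"
  by (cases m) (auto simp: fps_X_mult_nth)

text \<open>Multiplication by \<open>inverse (1 - fps_X)\<close> sums from index 0. The vanishing
  constant term lets the sum start at 1 for \<open>s = 0\<close>; for \<open>s = 1\<close> the extra
  \<open>fps_X\<close> shifts it. The result has the shape of
  \<open>card_gap_maps_top\<close>.\<close>

lemma fps_nth_partial_sums:
  fixes H :: "rat fps"
  assumes "s \<le> 1" "fps_nth H 0 = 0"
  shows "fps_nth (fps_X ^ s * inverse (1 - fps_X) * H) m = (\<Sum>v=1..m. fps_nth H (v - s))"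
proof -
  have ps: "fps_nth (inverse (1 - fps_X) * H) n = (\<Sum>i=0..n. fps_nth H i)" for n
    unfolding fps_inverse_one_minus_fps_X by (simp add: mult.commute[of _ H] fps_mult_nth)
  show ?thesis
  proof (cases "s = 0")
    case True
    then show ?thesis using assms(2) by (simp add: ps sum.atLeast_Suc_atMost)
  next
    case False
    with assms(1) have s: "s = 1" by simp
    have "(\<Sum>v=1..Suc n. fps_nth H (v - 1)) = (\<Sum>i=0..n. fps_nth H i)" for n
      using sum.shift_bounds_cl_Suc_ivl[of "\<lambda>v. fps_nth H (v - 1)" 0 n] by simp
    then show ?thesis by (cases m) (auto simp: s mult.assoc fps_X_mult_nth ps)
  qed
qed

lemma fps_nth_top_step:
  assumes "s \<le> 1" "finite P" "z \<notin> P" "\<not> lt z z" "\<And>x. x \<in> P \<Longrightarrow> lt x z \<and> \<not> lt z x"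
    and "fps_nth H 0 = 0" "\<And>m. fps_nth H m = of_nat (card (gap_maps s lt P m))"
  shows "fps_nth (fps_X ^ s * inverse (1 - fps_X) * H) m =
    (of_nat (card (gap_maps s lt (insert z P) m)) :: rat)"
  using assms by (simp add: fps_nth_partial_sums card_gap_maps_top)

text \<open>The series is \<open>1/(1-x)\<close> for \<open>s = 0\<close> and \<open>x/(1-x)\<close>
  for \<open>s = 1\<close>. The empty poset has one map for every \<open>m\<close>, so at
  \<open>m = 0\<close> the second series disagrees with it; hence the condition
  \<open>m \<ge> 1\<close>.\<close>

lemma stirling_fps_Nil:
  assumes "s \<le> 1" "m \<ge> 1"
  shows "fps_nth (stirling_fps s []) m = 1"
proof -
  have "stirling_perms [] = {[]}" by (auto simp: stirling_perms_def)
  moreover have "descents [] = {}" by (simp add: descents_def)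
  moreover have "s = 0 \<or> s = 1" using assms(1) by auto
  ultimately show ?thesis
    using assms(2)
    by (auto simp: stirling_fps_def descent_exponent_def fps_inverse_one_minus_fps_X fps_X_mult_nth)
qed

lemma stirling_fps_append_ones:
  assumes "s \<le> 1"
  shows "fps_nth (stirling_fps s (k @ replicate n 1)) m = of_nat (m ^ n) * fps_nth (stirling_fps s k) m"
proof (induction n)
  case (Suc n)
  have "k @ replicate (Suc n) 1 = (k @ replicate n 1) @ [1]"
    by (simp add: replicate_append_same)
  then show ?case
    using Suc stirling_fps_snoc[of 1 s "k @ replicate n 1"] assms
    by (simp add: fps_nth_X_deriv del: replicate.simps)
qed simp

lemma stirling_less_of_carrier:
  assumes "x \<in> stirling_carrier as ts 0" "i > length ts"
  shows "stirling_less x (C i) \<and> \<not> stirling_less (C i) x \<and> \<not> stirling_less (U i j) x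
    \<and> stirling_less x (D i j) \<and> \<not> stirling_less (D i j) x"
  using assms by (auto simp: stirling_carrier_def)

text \<open>\<open>U i j\<close> lies only below \<open>C\<close> and \<open>D\<close> of index at
  least \<open>i\<close>, and \<open>i > length ts\<close> excludes these from the carrier; so each
  new \<open>U\<close> is isolated at this stage.\<close>

lemma card_gap_maps_add_U:
  assumes "i > length ts"
  shows "card (gap_maps s stirling_less (U i ` {1..n} \<union> stirling_carrier as ts 0) m) =
    m ^ n * card (gap_maps s stirling_less (stirling_carrier as ts 0) m)"
proof (induction n)
  case (Suc n)
  let ?P = "U i ` {1..n} \<union> stirling_carrier as ts 0"
  have "U i ` {1..Suc n} \<union> stirling_carrier as ts 0 = insert (U i (Suc n)) ?P"
    by (auto simp: atLeastAtMostSuc_conv)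
  moreover have "card (gap_maps s stirling_less (insert (U i (Suc n)) ?P) m) =
      m * card (gap_maps s stirling_less ?P m)"
  proof (rule card_gap_maps_isolated)
    show "U i (Suc n) \<notin> ?P" using assms by (auto simp: stirling_carrier_def)
    show "\<not> stirling_less x (U i (Suc n)) \<and> \<not> stirling_less (U i (Suc n)) x"
      if "x \<in> insert (U i (Suc n)) ?P" for x
    proof -
      have "\<not> stirling_less x (U i (Suc n))" by (cases x) auto
      then show ?thesis using that stirling_less_of_carrier[OF _ assms] by auto
    qed
  qed (simp add: finite_stirling_carrier)
  ultimately show ?case using Suc by simp
qed simp

lemma card_gap_maps_add_E:
  "card (gap_maps s stirling_less (stirling_carrier as ts a) m) =
    m ^ a * card (gap_maps s stirling_less (stirling_carrier as ts 0) m)"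
proof (induction a)
  case (Suc a)
  have "card (gap_maps s stirling_less (stirling_carrier as ts (Suc a)) m) =
      m * card (gap_maps s stirling_less (stirling_carrier as ts a) m)"
    unfolding stirling_carrier_Suc
  proof (rule card_gap_maps_isolated)
    show "E (Suc a) \<notin> stirling_carrier as ts a" by (auto simp: stirling_carrier_def)
    show "\<not> stirling_less x (E (Suc a)) \<and> \<not> stirling_less (E (Suc a)) x" for x
      by (cases x) auto
  qed (simp add: finite_stirling_carrier)
  then show ?case using Suc by simp
qed simp

text \<open>The \<open>x - 1\<close> ones and the derivative for the entry \<open>t\<close> multiply
  the coefficients by \<open>m\<close> altogether \<open>x\<close> times, once per \<open>U\<close>.
  The \<open>t - 1\<close> factors \<open>?G\<close> account for \<open>C\<close> and the
  \<open>t - 2\<close> elements \<open>D\<close>.\<close>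

lemma stirling_fps_block:
  assumes "s \<le> 1" "x \<ge> 1" "t \<ge> 2" "length as = length ts"
    and IH: "\<And>m. m \<ge> 1 \<Longrightarrow> fps_nth (stirling_fps s k) m =
      of_nat (card (gap_maps s stirling_less (stirling_carrier as ts 0) m))"
  shows "fps_nth (stirling_fps s (k @ replicate (x - 1) 1 @ [t])) m =
    of_nat (card (gap_maps s stirling_less (stirling_carrier (as @ [x]) (ts @ [t]) 0) m))"
proof -
  let ?i = "Suc (length ts)" and ?G = "fps_X ^ s * inverse (1 - fps_X) :: rat fps"
  let ?P = "U ?i ` {1..x} \<union> stirling_carrier as ts 0"
  let ?Q = "\<lambda>q. D ?i ` {1..q} \<union> insert (C ?i) ?P"
  \<comment> \<open>\<open>H\<close> includes the derivative that belongs to the entry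
    \<open>t\<close>, but none of its factors \<open>?G\<close>.\<close>
  define H where "H = fps_X * fps_deriv (stirling_fps s (k @ replicate (x - 1) 1))"
  have "fps_nth H m = of_nat (m ^ x) * fps_nth (stirling_fps s k) m" for m
    unfolding H_def fps_nth_X_deriv stirling_fps_append_ones[OF assms(1)]
    using assms(2) by (cases x) auto
  \<comment> \<open>At \<open>m = 0\<close>, which \<open>IH\<close> does not cover, both sides
    vanish through \<open>m ^ x\<close> with \<open>x \<ge> 1\<close>. The partial sums below need
    this value too.\<close>
  then have H: "fps_nth H m = of_nat (card (gap_maps s stirling_less ?P m))" for m
    unfolding card_gap_maps_add_U[OF lessI] using IH assms(2) by (cases m) auto
  have H0: "fps_nth H 0 = 0" by (simp add: H_def)
  \<comment> \<open>The first factor adjoins \<open>C ?i\<close>, so \<open>q\<close> elements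
    \<open>D\<close> go with \<open>Suc q\<close> factors.\<close>
  have "fps_nth (?G ^ Suc q * H) m = of_nat (card (gap_maps s stirling_less (?Q q) m))" for q m
  proof (induction q arbitrary: m)
    case 0
    have "fps_nth (?G * H) m = of_nat (card (gap_maps s stirling_less (insert (C ?i) ?P) m))"
    proof (rule fps_nth_top_step[OF assms(1) _ _ _ _ H0 H])
      show "C ?i \<notin> ?P" by (auto simp: stirling_carrier_def)
      show "stirling_less y (C ?i) \<and> \<not> stirling_less (C ?i) y" if "y \<in> ?P" for y
        using that stirling_less_of_carrier[OF _ lessI] by auto
    qed (simp_all add: finite_stirling_carrier)
    then show ?case by simp
  next
    case (Suc q)
    have "?Q (Suc q) = insert (D ?i (Suc q)) (?Q q)"
      by (auto simp: atLeastAtMostSuc_conv)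
    moreover have "fps_nth (?G * (?G ^ Suc q * H)) m =
        of_nat (card (gap_maps s stirling_less (insert (D ?i (Suc q)) (?Q q)) m))"
    proof (rule fps_nth_top_step[OF assms(1)])
      show "D ?i (Suc q) \<notin> ?Q q" by (auto simp: stirling_carrier_def)
      show "stirling_less y (D ?i (Suc q)) \<and> \<not> stirling_less (D ?i (Suc q)) y" if "y \<in> ?Q q" for y
        using that stirling_less_of_carrier[OF _ lessI] by auto
      show "fps_nth (?G ^ Suc q * H) 0 = 0" by (simp add: H0)
    qed (use Suc in \<open>simp_all add: finite_stirling_carrier\<close>)
    ultimately show ?case by (simp add: mult.assoc)
  qed
  moreover have "stirling_fps s (k @ replicate (x - 1) 1 @ [t]) = ?G ^ Suc (t - 2) * H"
    using stirling_fps_snoc[of t s "k @ replicate (x - 1) 1"] assms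
    by (simp add: H_def Suc_diff_Suc numeral_2_eq_2)
  ultimately show ?thesis
    by (simp only: stirling_carrier_snoc[OF assms(4)])
qed

text \<open>Induction from the right: the last entry of \<open>k\<close> belongs to the largest
  letter, and the last \<open>C\<close> and \<open>D\<close> lie above all earlier segments.\<close>

lemma stirling_fps_weight:
  assumes "s \<le> 1" "length as = length ts" "\<forall>x\<in>set as. x \<ge> 1" "\<forall>t\<in>set ts. t \<ge> 2" "m \<ge> 1"
  shows "fps_nth (stirling_fps s (concat (map2 (\<lambda>x t. replicate (x - 1) 1 @ [t]) as ts))) m =
    of_nat (card (gap_maps s stirling_less (stirling_carrier as ts 0) m))"
  using assms(2-)
proof (induction ts arbitrary: as m rule: rev_induct)
  case Nil
  then show ?case
    using stirling_fps_Nil[OF assms(1)] by (simp add: stirling_carrier_Nil gap_maps_def)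
next
  case (snoc t ts)
  then obtain as' x where as: "as = as' @ [x]" by (cases as rule: rev_cases) auto
  with snoc have "fps_nth (stirling_fps s
        (concat (map2 (\<lambda>x t. replicate (x - 1) 1 @ [t]) as' ts) @ replicate (x - 1) 1 @ [t])) m =
      of_nat (card (gap_maps s stirling_less (stirling_carrier (as' @ [x]) (ts @ [t]) 0) m))"
    by (intro stirling_fps_block assms(1)) auto
  with as snoc show ?case by simp
qed

lemma stirling_fps_eq_gap_maps:
  assumes "s \<le> 1" "has_weight k as ts a" "m \<ge> 1"
  shows "fps_nth (stirling_fps s k) m =
    of_nat (card (gap_maps s stirling_less (stirling_carrier as ts a) m))"
proof -
  let ?k = "concat (map2 (\<lambda>x t. replicate (x - 1) 1 @ [t]) as ts)"
  from assms(2) have w: "length as = length ts" "\<forall>x\<in>set as. x \<ge> 1" "\<forall>t\<in>set ts. t \<ge> 2"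
    and k: "k = ?k @ replicate a 1"
    by (auto simp: has_weight_def)
  \<comment> \<open>The trailing ones of \<open>k\<close> and the elements \<open>E\<close> both
    contribute the factor \<open>m ^ a\<close>.\<close>
  show ?thesis
    unfolding k card_gap_maps_add_E[of s as ts a] stirling_fps_append_ones[OF assms(1)]
    by (simp only: stirling_fps_weight[OF assms(1) w assms(3)] of_nat_mult)
qed

theorem theorem2:
  fixes k as ts :: "nat list" and a m :: nat
  assumes "k \<noteq> []"
    and "\<forall>x\<in>set k. x > 0"
    and "has_weight k as ts a"
    and "m > 0"
  shows "B_num k m = of_nat (Omega (stirling_carrier as ts a) (stirling_order as ts a) m) \<and>
         b_num k m = of_nat (Omega_strict (stirling_carrier as ts a) (stirling_order as ts a) m)"
proof -
  have ts: "\<forall>t\<in>set ts. t \<ge> 2" using assms(3) by (simp add: has_weight_def)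
  have m: "m \<ge> 1" using assms(4) by simp
  have "fps_nth (stirling_fps 0 k) m =
      of_nat (Omega (stirling_carrier as ts a) (stirling_order as ts a) m)"
    unfolding Omega_eq_gap_maps[OF ts] by (rule stirling_fps_eq_gap_maps[OF _ assms(3) m]) simp
  moreover have "fps_nth (stirling_fps 1 k) m =
      of_nat (Omega_strict (stirling_carrier as ts a) (stirling_order as ts a) m)"
    unfolding Omega_strict_eq_gap_maps[OF ts]
    by (rule stirling_fps_eq_gap_maps[OF _ assms(3) m]) simp
  ultimately show ?thesis
    by (simp only: B_num_eq_stirling_fps[OF assms(1,2)] b_num_eq_stirling_fps[OF assms(1,2)])
qed

end
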